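(* Consider the CODA dynamics on the complete graph on $n\ge2$ agents. Assume that $n^+(0)=n^-(0)$ (so that $n$ is even) and moreover that for all $i\in\{1,\dots,\frac n2\}$ there exists $\eta_i(0)\in(0,\frac12)$ such that $$p_i(0)=\frac12-\eta_i(0)\quad\text{and}\quad p_{\frac n2+i}(0)=\frac12+\eta_i(0).$$ Then $n^+(k)=n^-(k)$ for all $k\in\mathbb{N}$, and there exists $k^*\in\mathbb{N}$ such that for all $k\ge k^*$ and all $j\in\mathcal{V}$, $$\left|p_j(k)-\frac12\right|\le\epsilon^*\quad\text{and}\quad\left(p_j(k)-\frac12\right)\left(p_j(k+1)-\frac12\right)<0,$$ where $\epsilon^*<\frac{1}{6(n-1)}$ is the unique positive solution of the equation $$x^3+\frac{1}{2(n-1)}x^2+\frac34x-\frac{1}{8(n-1)}=0.$$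
   Context: $\mathcal{V}=\{1,\dots,n\}$ is the set of agents; the interaction graph is complete, i.e. the set of agents influencing $i$ is $N_i=\mathcal{V}\setminus\{i\}$, and $n_i=|N_i|=n-1$. Time is $k\in\mathbb{N}=\{0,1,2,\dots\}$. Each agent has an opinion $p_i(k)$, with initial opinions $p_i(0)\in(0,1)$, $p_i(0)\ne\frac12$, and an action $q_i(k)\in\{0,1\}$ defined by: $q_i(k)=0$ if $p_i(k)<\frac12$; $q_i(k)=0$ if $p_i(k)=\frac12$ and $p_i(k-1)<\frac12$; $q_i(k)=1$ otherwise. The CODA (continuous opinions, discrete actions) dynamics is $$p_i(k+1)=p_i(k)+\frac{p_i(k)(1-p_i(k))}{n_i}\sum_{j\in N_i}(q_j(k)-p_i(k)),\qquad i\in\mathcal{V},\ k\in\mathbb{N}.$$ $n^-(k)$ and $n^+(k)$ denote the numbers of agents $i\in\mathcal{V}$ with $q_i(k)=0$ and $q_i(k)=1$, respectively. *)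

theory Defs
  imports Complex_Main
begin

text \<open>Agents are \<open>{1..n}\<close>; \<open>p i k\<close> is the opinion of agent \<open>i\<close> at time \<open>k\<close>.\<close>

definition agents :: "nat \<Rightarrow> nat set" where
  "agents n = {1..n}"

definition nbrs :: "nat \<Rightarrow> nat \<Rightarrow> nat set" where
  "nbrs n i = agents n - {i}"

text \<open>The tie-breaking clause refers to the previous time step, so it is guarded by \<open>0 < k\<close>.
  It plays no role at time 0, where opinions are assumed to differ from \<open>1/2\<close>.\<close>

definition action :: "(nat \<Rightarrow> nat \<Rightarrow> real) \<Rightarrow> nat \<Rightarrow> nat \<Rightarrow> nat" where
  "action p i k =
     (if p i k < 1/2 then 0
      else if p i k = 1/2 \<and> 0 < k \<and> p i (k - 1) < 1/2 then 0
      else 1)"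

definition coda_dynamics :: "nat \<Rightarrow> (nat \<Rightarrow> nat \<Rightarrow> real) \<Rightarrow> bool" where
  "coda_dynamics n p \<longleftrightarrow>
     (\<forall>i \<in> agents n. 0 < p i 0 \<and> p i 0 < 1 \<and> p i 0 \<noteq> 1/2) \<and>
     (\<forall>i \<in> agents n. \<forall>k.
        p i (Suc k) = p i k + p i k * (1 - p i k) / real (card (nbrs n i))
          * (\<Sum>j \<in> nbrs n i. real (action p j k) - p i k))"

definition n_minus :: "nat \<Rightarrow> (nat \<Rightarrow> nat \<Rightarrow> real) \<Rightarrow> nat \<Rightarrow> nat" where
  "n_minus n p k = card {i \<in> agents n. action p i k = 0}"

definition n_plus :: "nat \<Rightarrow> (nat \<Rightarrow> nat \<Rightarrow> real) \<Rightarrow> nat \<Rightarrow> nat" where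
  "n_plus n p k = card {i \<in> agents n. action p i k = 1}"

end

theory Submission imports Defs begin

text \<open>
  Put \<open>c = 1 / (n - 1)\<close> and let \<open>f x = x^3 + c/2 x^2 + 3/4 x - c/8\<close>. As long as the actions are
  balanced, an agent at distance \<open>y\<close> from \<open>1/2\<close>, on the side indicated by its action, moves to
  the position \<open>f y\<close> measured on the same side; so its distance evolves autonomously by
  \<open>y \<mapsto> \<bar>f y\<bar>\<close>, and it switches side exactly when \<open>f y < 0\<close>. Agents \<open>i\<close> and \<open>n/2 + i\<close> start at the
  same distance on opposite sides and hence stay so, which keeps the actions balanced.
  On \<open>[0, 1/2)\<close> the map \<open>f\<close> is increasing with unique zero \<open>\<epsilon>\<^sup>*\<close>; above \<open>\<epsilon>\<^sup>*\<close> the distance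
  decreases by a definite amount, and \<open>[0, \<epsilon>\<^sup>*]\<close> is mapped into \<open>[0, c/8]\<close> with \<open>c/8 < \<epsilon>\<^sup>*\<close>.
\<close>

section \<open>The cubic map, its positive zero, and the iteration of its absolute value\<close>

definition coda_map :: "real \<Rightarrow> real \<Rightarrow> real" where
  "coda_map c x = x^3 + c/2 * x^2 + 3/4 * x - c/8"

text \<open>This form shows the decrement as a product that is positive for
  \<open>0 \<le> x < 1/2\<close> when \<open>c > 0\<close>; it is also the shape in which the
  dynamics produces the map.\<close>

lemma coda_map_alt: "coda_map c x = x - (1/4 - x^2) * (c/2 + x)"
  by (simp add: coda_map_def algebra_simps power2_eq_square power3_eq_cube)

lemma coda_map_0 [simp]: "coda_map c 0 = - (c/8)"
  by (simp add: coda_map_def)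

lemma coda_map_strict_mono:
  assumes "0 < c" "0 \<le> x" "x < y"
  shows "coda_map c x < coda_map c y"
proof -
  have "x^3 \<le> y^3" "x^2 \<le> y^2"
    using assms by (auto intro: power_mono)
  then have "x^3 + c/2 * x^2 \<le> y^3 + c/2 * y^2"
    using assms(1) by (intro add_mono mult_left_mono) auto
  then show ?thesis
    using assms(3) by (simp add: coda_map_def)
qed

lemma coda_map_less_iff:
  assumes "0 < c" "0 \<le> x" "0 \<le> y"
  shows "coda_map c x < coda_map c y \<longleftrightarrow> x < y"
  using coda_map_strict_mono[OF assms(1,2), of y] coda_map_strict_mono[OF assms(1,3), of x]
  by (metis less_asym linorder_neqE_linordered_idom)

lemma coda_map_le_iff:
  assumes "0 < c" "0 \<le> x" "0 \<le> y"
  shows "coda_map c x \<le> coda_map c y \<longleftrightarrow> x \<le> y"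
  using coda_map_less_iff[OF assms(1,3,2)] by (metis not_less)

lemma coda_map_zero_exists:
  assumes "0 < c" "c \<le> 1"
  obtains e where "coda_map c e = 0" "c/8 < e" "e < c/6"
proof -
  have "c^2 \<le> 1"
    using assms by (simp add: power_le_one)
  \<comment> \<open>\<open>coda_map c (c/8)\<close> equals this product divided by 512.\<close>
  then have "c * (5 * c^2 - 16) < 0"
    using assms(1) by (intro mult_pos_neg) auto
  then have lo: "coda_map c (c/8) < 0"
    by (simp add: coda_map_def field_simps power2_eq_square power3_eq_cube)
  \<comment> \<open>The linear and constant terms cancel at \<open>c/6\<close>, leaving
    \<open>c^3 / 54\<close>.\<close>
  have "0 < c^3"
    using assms(1) by simp
  then have hi: "0 < coda_map c (c/6)"
    by (simp add: coda_map_def field_simps power2_eq_square power3_eq_cube)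
  have "\<forall>x. c/8 \<le> x \<and> x \<le> c/6 \<longrightarrow> isCont (coda_map c) x"
    unfolding coda_map_def by (intro allI impI continuous_intros)
  then obtain e where "c/8 \<le> e" "e \<le> c/6" "coda_map c e = 0"
    using IVT[of "coda_map c" "c/8" 0 "c/6"] lo hi assms(1) by auto
  with lo hi have "c/8 < e" "e < c/6"
    by (metis less_irrefl order_le_less)+
  with that show ?thesis
    using \<open>coda_map c e = 0\<close> by blast
qed

lemma abs_coda_map_iteration_eventually:
  fixes u :: "nat \<Rightarrow> real"
  assumes c: "0 < c" "c \<le> 1"
    and e: "coda_map c e = 0" "c/8 < e"
    and u0: "0 \<le> u 0" "u 0 < 1/2"
    and step: "\<And>k. u (Suc k) = \<bar>coda_map c (u k)\<bar>"
  shows "eventually (\<lambda>k. 0 < u k \<and> u k < e) sequentially"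
proof -
  have nonneg: "0 \<le> u k" for k
    using u0 step by (cases k) auto
  have neg_iff: "coda_map c (u k) < 0 \<longleftrightarrow> u k < e" for k
    using coda_map_less_iff[OF c(1) nonneg, of e k] c e by simp
  have nonpos_iff: "coda_map c (u k) \<le> 0 \<longleftrightarrow> u k \<le> e" for k
    using coda_map_le_iff[OF c(1) nonneg, of e k] c e by simp
  have lower: "- (c/8) \<le> coda_map c (u k)" for k
    using coda_map_le_iff[OF c(1) _ nonneg, of 0 k] nonneg[of k] by simp
  have into: "u (Suc k) < e" if "u k \<le> e" for k
    using that nonpos_iff[of k] lower[of k] step[of k] e by simp
  have stays: "0 < u (Suc k) \<and> u (Suc k) < e" if "u k < e" for k
    using that neg_iff[of k] into[of k] step[of k] by simp
  obtain K where K: "u K \<le> e"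
  proof (rule ccontr)
    assume "\<not> thesis"
    with that have above: "e < u k" for k
      by (metis not_less)
    \<comment> \<open>A uniform lower bound for the decrement in \<open>coda_map_alt\<close>: the
      first factor is smallest at \<open>u 0\<close>, and the second is at least
      \<open>c/2\<close>.\<close>
    define d where "d = (1/4 - (u 0)^2) * (c/2)"
    have "(u 0)^2 < (1/2)^2"
      using u0 by (intro power_strict_mono) auto
    then have "0 < d"
      using c by (simp add: d_def power2_eq_square)
    have bound: "u k \<le> u 0 - real k * d" for k
    proof (induction k)
      case (Suc k)
      have "0 \<le> real k * d"
        using \<open>0 < d\<close> by simp
      with Suc have "u k \<le> u 0"
        by linarith
      then have "(u k)^2 \<le> (u 0)^2"
        using nonneg by (intro power_mono)
      then have "d \<le> (1/4 - (u k)^2) * (c/2 + u k)"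
        unfolding d_def using nonneg[of k] c \<open>(u 0)^2 < (1/2)^2\<close>
        by (intro mult_mono) (auto simp: power2_eq_square)
      moreover have "u (Suc k) = coda_map c (u k)"
        using step[of k] above[of k] nonpos_iff[of k] by simp
      ultimately show ?case
        using Suc by (simp add: coda_map_alt algebra_simps)
    qed simp
    obtain N where "u 0 < real N * d"
      using \<open>0 < d\<close> reals_Archimedean3 by blast
    with bound[of N] nonneg[of N] show False
      by linarith
  qed
  \<comment> \<open>One step after \<open>K\<close> gives the strict upper bound, and the next one
    positivity; hence the offset 2.\<close>
  have "0 < u (K + 2 + k) \<and> u (K + 2 + k) < e" for k
  proof (induction k)
    case 0
    show ?case
      using stays[OF into[OF K]] by simp
  next
    case (Suc k)
    then show ?case
      using stays[of "K + 2 + k"] by simp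
  qed
  then show ?thesis
    unfolding eventually_sequentially by (metis le_add_diff_inverse)
qed

section \<open>Actions, their counts, and one step of the dynamics\<close>

lemma action_cases: "action p i k = 0 \<or> action p i k = 1"
  by (simp add: action_def)

text \<open>A tie at \<open>1/2\<close> may be resolved either way, so both bounds are weak.\<close>

lemma action_side:
  obtains "action p i k = 0" "p i k \<le> 1/2" | "action p i k = 1" "p i k \<ge> 1/2"
  by (cases "p i k < 1/2"; cases "p i k = 1/2 \<and> 0 < k \<and> p i (k - 1) < 1/2")
    (auto simp: action_def)

lemma n_plus_eq_sum: "n_plus n p k = (\<Sum>j \<in> agents n. action p j k)"
proof -
  have "(\<Sum>j \<in> agents n. action p j k) = (\<Sum>j \<in> agents n. if action p j k = 1 then 1 else 0)"
    using action_cases by (intro sum.cong) (metis zero_neq_one)+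
  also have "\<dots> = n_plus n p k"
    by (simp add: n_plus_def agents_def flip: sum.inter_filter)
  finally show ?thesis by simp
qed

lemma n_plus_add_n_minus: "n_plus n p k + n_minus n p k = n"
proof -
  have "n_plus n p k + n_minus n p k
      = card ({i \<in> agents n. action p i k = 1} \<union> {i \<in> agents n. action p i k = 0})"
    unfolding n_plus_def n_minus_def by (subst card_Un_disjoint) (auto simp: agents_def)
  also have "{i \<in> agents n. action p i k = 1} \<union> {i \<in> agents n. action p i k = 0} = agents n"
    using action_cases by blast
  finally show ?thesis
    by (simp add: agents_def)
qed

lemma sum_split_halves:
  fixes f :: "nat \<Rightarrow> 'a::comm_monoid_add"
  shows "sum f {1..2 * m} = (\<Sum>i = 1..m. f i + f (m + i))"
proof -
  have "sum f {1..2 * m} = sum f {1..m} + sum f {1 + m..m + m}"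
    using sum.ub_add_nat[of 1 m f m] by (simp add: mult_2)
  also have "sum f {1 + m..m + m} = (\<Sum>i = 1..m. f (i + m))"
    by (rule sum.shift_bounds_cl_nat_ivl)
  finally show ?thesis
    by (simp add: sum.distrib add.commute)
qed

text \<open>Balance makes the sum of all actions \<open>n/2\<close>, so the other agents enter only
  through the agent's own action. The factor \<open>2 * real (action p j k) - 1\<close> is the sign
  of its side.\<close>

lemma coda_step_balanced:
  assumes n: "n = 2 * m" "n \<ge> 2" and dyn: "coda_dynamics n p" and j: "j \<in> agents n"
    and bal: "n_plus n p k = m"
  shows "p j (Suc k) - 1/2
    = (2 * real (action p j k) - 1) * coda_map (1 / (real n - 1)) \<bar>p j k - 1/2\<bar>"
proof -
  define c where "c = 1 / (real n - 1)"
  define q where "q = real (action p j k)"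
  have card: "real (card (nbrs n j)) = real n - 1"
    using j n(2) by (simp add: nbrs_def agents_def card_Diff_singleton of_nat_diff)
  have "(\<Sum>i \<in> nbrs n j. real (action p i k)) = (\<Sum>i \<in> agents n. real (action p i k)) - q"
    using j by (simp add: nbrs_def q_def sum_diff1 agents_def)
  also have "(\<Sum>i \<in> agents n. real (action p i k)) = real n / 2"
    using bal n(1) by (simp add: n_plus_eq_sum flip: of_nat_sum)
  finally have "(\<Sum>i \<in> nbrs n j. real (action p i k) - p j k)
      = real n / 2 - q - (real n - 1) * p j k"
    by (simp add: sum_subtractf card)
  moreover have "(real n / 2 - q - (real n - 1) * p j k) / (real n - 1)
      = c/2 * (1 - 2 * q) - (p j k - 1/2)"
    using n(2) by (simp add: c_def field_simps)
  ultimately have "p j (Suc k) = p j k + p j k * (1 - p j k) * (c/2 * (1 - 2 * q) - (p j k - 1/2))"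
    using dyn j card unfolding coda_dynamics_def by (metis times_divide_eq_left times_divide_eq_right)
  \<comment> \<open>Recentred at \<open>1/2\<close>, the factor \<open>p * (1 - p)\<close> becomes
    \<open>1/4 - (p - 1/2)^2\<close>.\<close>
  then have eq: "p j (Suc k) - 1/2 = (p j k - 1/2)
      + (1/4 - (p j k - 1/2)^2) * (c/2 * (1 - 2 * q) - (p j k - 1/2))"
    by (simp add: algebra_simps power2_eq_square)
  consider "q = 0" "p j k \<le> 1/2" | "q = 1" "p j k \<ge> 1/2"
    unfolding q_def by (rule action_side[of p j k]) auto
  then show ?thesis
  proof cases
    case 1
    then show ?thesis
      unfolding c_def[symmetric] q_def[symmetric] eq
      by (simp add: coda_map_alt algebra_simps power2_commute)
  next
    case 2
    then show ?thesis
      unfolding c_def[symmetric] q_def[symmetric] eq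
      by (simp add: coda_map_alt algebra_simps)
  qed
qed

text \<open>When \<open>coda_map\<close> vanishes the agent lands on \<open>1/2\<close>, and since \<open>coda_map c 0 < 0\<close> it was not
  there one step earlier; so the tie-breaking rule keeps its action.\<close>

lemma action_Suc:
  assumes step: "p j (Suc k) - 1/2 = (2 * real (action p j k) - 1) * coda_map c \<bar>p j k - 1/2\<bar>"
    and c: "0 < c"
  shows "action p j (Suc k)
    = (if coda_map c \<bar>p j k - 1/2\<bar> \<ge> 0 then action p j k else 1 - action p j k)"
proof -
  define f where "f = coda_map c \<bar>p j k - 1/2\<bar>"
  have off: "p j k \<noteq> 1/2" if "f = 0"
  proof
    assume eq: "p j k = 1/2"
    have "f = - (c/8)"
      unfolding f_def eq by simp
    with that c show False
      by simp
  qed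
  show ?thesis
  proof (cases rule: action_side[of p j k])
    case 1
    then have "p j (Suc k) = 1/2 - f"
      using step by (simp add: f_def)
    then show ?thesis
      using 1 off unfolding f_def[symmetric] by (auto simp: action_def[of p j "Suc k"])
  next
    case 2
    then have "p j (Suc k) = 1/2 + f"
      using step by (simp add: f_def)
    then show ?thesis
      using 2 off unfolding f_def[symmetric] by (auto simp: action_def[of p j "Suc k"])
  qed
qed

section \<open>Symmetric pairs and preservation of balance\<close>

lemma balanced_of_complementary:
  assumes "\<forall>i \<in> {1..m}. action p i k + action p (m + i) k = 1"
  shows "n_plus (2 * m) p k = m"
proof -
  have "n_plus (2 * m) p k = (\<Sum>i = 1..m. action p i k + action p (m + i) k)"
    unfolding n_plus_eq_sum agents_def by (rule sum_split_halves)
  also have "\<dots> = (\<Sum>i = 1..m. 1)"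
    using assms by (intro sum.cong) auto
  finally show ?thesis by simp
qed

text \<open>Both claims are needed in the induction: complementary actions give balance, so the step
  formula applies, and equal distances give both partners the same value of the map, so they keep or
  switch sides together.\<close>

lemma symmetric_actions_complementary:
  assumes n: "n = 2 * m" "n \<ge> 2" and dyn: "coda_dynamics n p"
    and init: "\<forall>i \<in> {1..m}. \<exists>\<eta>::real. 0 < \<eta> \<and> \<eta> < 1/2 \<and>
           p i 0 = 1/2 - \<eta> \<and> p (m + i) 0 = 1/2 + \<eta>"
  shows "\<forall>i \<in> {1..m}. \<bar>p i k - 1/2\<bar> = \<bar>p (m + i) k - 1/2\<bar> \<and>
           action p i k + action p (m + i) k = 1"
proof (induction k)
  case 0
  show ?case
    using init by (fastforce simp: action_def)
next
  case (Suc k)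
  define c where "c = 1 / (real n - 1)"
  have c: "0 < c"
    using n(2) by (simp add: c_def)
  have "n_plus n p k = m"
    using balanced_of_complementary[of m p k] Suc n(1) by auto
  note step = coda_step_balanced[OF n dyn _ this, folded c_def]
  show ?case
  proof
    fix i assume i: "i \<in> {1..m}"
    then have ag: "i \<in> agents n" "m + i \<in> agents n"
      using n(1) by (auto simp: agents_def)
    have IH: "\<bar>p (m + i) k - 1/2\<bar> = \<bar>p i k - 1/2\<bar>" "action p i k + action p (m + i) k = 1"
      using Suc i by auto
    have "\<bar>p i (Suc k) - 1/2\<bar> = \<bar>p (m + i) (Suc k) - 1/2\<bar>"
      using step[OF ag(1)] step[OF ag(2)] IH action_cases[of p i k] by auto
    moreover have "action p i (Suc k) + action p (m + i) (Suc k) = 1"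
      using action_Suc[OF step[OF ag(1)] c] action_Suc[OF step[OF ag(2)] c] IH
        action_cases[of p i k] by auto
    ultimately show "\<bar>p i (Suc k) - 1/2\<bar> = \<bar>p (m + i) (Suc k) - 1/2\<bar> \<and>
        action p i (Suc k) + action p (m + i) (Suc k) = 1" ..
  qed
qed

theorem proposition12:
  fixes n :: nat and p :: "nat \<Rightarrow> nat \<Rightarrow> real"
  assumes "n \<ge> 2"
    and "coda_dynamics n p"
    and "n_plus n p 0 = n_minus n p 0"
    and "\<forall>i \<in> {1..n div 2}. \<exists>\<eta>::real. 0 < \<eta> \<and> \<eta> < 1/2 \<and>
           p i 0 = 1/2 - \<eta> \<and> p (n div 2 + i) 0 = 1/2 + \<eta>"
  shows "(\<forall>k. n_plus n p k = n_minus n p k) \<and>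
    (\<exists>\<epsilon>::real.
       (0 < \<epsilon> \<and> \<epsilon>^3 + 1 / (2 * (real n - 1)) * \<epsilon>^2 + 3/4 * \<epsilon> - 1 / (8 * (real n - 1)) = 0) \<and>
       (\<forall>x::real. 0 < x \<and> x^3 + 1 / (2 * (real n - 1)) * x^2 + 3/4 * x - 1 / (8 * (real n - 1)) = 0
          \<longrightarrow> x = \<epsilon>) \<and>
       \<epsilon> < 1 / (6 * (real n - 1)) \<and>
       (\<exists>K. \<forall>k \<ge> K. \<forall>j \<in> agents n.
          \<bar>p j k - 1/2\<bar> \<le> \<epsilon> \<and> (p j k - 1/2) * (p j (k + 1) - 1/2) < 0))"
proof -
  obtain m where m: "n = 2 * m"
    using n_plus_add_n_minus[of n p 0] assms(3) by (metis mult_2)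
  have init: "\<forall>i \<in> {1..m}. \<exists>\<eta>::real. 0 < \<eta> \<and> \<eta> < 1/2 \<and>
           p i 0 = 1/2 - \<eta> \<and> p (m + i) 0 = 1/2 + \<eta>"
    using assms(4) m by simp
  have plus: "n_plus n p k = m" for k
    using symmetric_actions_complementary[OF m assms(1,2) init, of k]
      balanced_of_complementary[of m p k] m by auto
  have minus: "n_minus n p k = m" for k
    using n_plus_add_n_minus[of n p k] plus[of k] m by simp
  define c where "c = 1 / (real n - 1)"
  have c: "0 < c" "c \<le> 1"
    using assms(1) by (auto simp: c_def)
  obtain e where e: "coda_map c e = 0" "c/8 < e" "e < c/6"
    using coda_map_zero_exists[OF c] .
  note step = coda_step_balanced[OF m assms(1,2) _ plus, folded c_def]
  have "\<forall>j \<in> agents n. eventually (\<lambda>k. 0 < \<bar>p j k - 1/2\<bar> \<and> \<bar>p j k - 1/2\<bar> < e) sequentially"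
  proof
    fix j assume j: "j \<in> agents n"
    have "0 < p j 0" "p j 0 < 1"
      using assms(2) j by (auto simp: coda_dynamics_def)
    then have "\<bar>p j 0 - 1/2\<bar> < 1/2"
      by linarith
    moreover have "\<bar>p j (Suc k) - 1/2\<bar> = \<bar>coda_map c \<bar>p j k - 1/2\<bar>\<bar>" for k
      using step[OF j, of k] action_cases[of p j k] by auto
    ultimately show "eventually (\<lambda>k. 0 < \<bar>p j k - 1/2\<bar> \<and> \<bar>p j k - 1/2\<bar> < e) sequentially"
      by (intro abs_coda_map_iteration_eventually[OF c e(1,2)]) auto
  qed
  \<comment> \<open>There are finitely many agents, so one threshold serves all of them.\<close>
  then have "eventually (\<lambda>k. \<forall>j \<in> agents n. 0 < \<bar>p j k - 1/2\<bar> \<and> \<bar>p j k - 1/2\<bar> < e) sequentially"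
    by (intro eventually_ball_finite) (auto simp: agents_def)
  then obtain K where K: "\<forall>k \<ge> K. \<forall>j \<in> agents n. 0 < \<bar>p j k - 1/2\<bar> \<and> \<bar>p j k - 1/2\<bar> < e"
    unfolding eventually_sequentially by blast
  have switch: "\<bar>p j k - 1/2\<bar> \<le> e \<and> (p j k - 1/2) * (p j (k + 1) - 1/2) < 0"
    if "k \<ge> K" "j \<in> agents n" for k j
  proof -
    define y where "y = \<bar>p j k - 1/2\<bar>"
    have y: "0 < y" "y < e"
      using K that by (auto simp: y_def)
    have "coda_map c y < 0"
      using coda_map_strict_mono[OF c(1) _ y(2)] y e(1) by simp
    then have "y * coda_map c y < 0"
      using y by (intro mult_pos_neg)
    \<comment> \<open>Both deviations carry the same sign factor, whose square is 1.\<close>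
    moreover have "(p j k - 1/2) * (p j (k + 1) - 1/2) = y * coda_map c y"
    proof -
      have now: "p j k - 1/2 = (2 * real (action p j k) - 1) * y"
        by (auto simp: y_def action_def)
      have later: "p j (k + 1) - 1/2 = (2 * real (action p j k) - 1) * coda_map c y"
        using step[OF that(2), of k] by (simp add: y_def)
      show ?thesis
        unfolding now later using action_cases[of p j k] by auto
    qed
    ultimately show ?thesis
      using y unfolding y_def by simp
  qed
  have cubic: "x^3 + 1 / (2 * (real n - 1)) * x^2 + 3/4 * x - 1 / (8 * (real n - 1)) = coda_map c x"
    for x
    by (simp add: coda_map_def c_def mult.commute)
  have unique: "x = e" if "0 < x" "coda_map c x = 0" for x
    using coda_map_strict_mono[OF c(1), of x e] coda_map_strict_mono[OF c(1), of e x] that e c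
    by (cases x e rule: linorder_cases) auto
  show ?thesis
    unfolding cubic
  proof (intro conjI allI exI[of _ e] impI exI[of _ K] ballI)
    show "e < 1 / (6 * (real n - 1))"
      using e(3) by (simp add: c_def mult.commute)
  qed (use plus minus c e unique switch in auto)
qed

end
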